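(* Let $p\in[\tfrac43,\,2+\sqrt2]$, let $\Omega\subset\mathbb{R}^2$ be a domain, and let $u=(u^1,u^2)\in C^2(\Omega,\mathbb{R}^2)$ be a $p$-harmonic mapping. If $\det H(u^2)\ge 0$ at a point of $\Omega$, then $\det H(u^1)\le 0$ at that point. Moreover, if $\det H(u^2)\ge 0$ holds in the whole domain $\Omega$, then the Gauss curvature satisfies $K_{u^1}\le 0$ in $\Omega$; respectively, if $\det H(u^1)\ge 0$ holds in the whole domain $\Omega$, then $K_{u^2}\le 0$ in $\Omega$.
   Context: For $1<p<\infty$, a map $u=(u^1,u^2):\Omega\subset\mathbb{R}^2\to\mathbb{R}^2$ is $p$-harmonic if it is a (weak) solution of the system $\operatorname{div}(|Du|^{p-2}\nabla u^1)=0$, $\operatorname{div}(|Du|^{p-2}\nabla u^2)=0$ in $\Omega$, where $|Du|^2=|\nabla u^1|^2+|\nabla u^2|^2$. For a $C^2$ function $v$ on $\Omega$, $H(v)$ denotes its Hessian matrix, so $\det H(v)=v_{xx}v_{yy}-(v_{xy})^2$, and $K_v=\dfrac{v_{xx}v_{yy}-(v_{xy})^2}{(1+v_x^2+v_y^2)^2}$ is the Gauss curvature of the surface $z=v(x,y)$. *)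

theory Defs
  imports "HOL-Analysis.Analysis"
begin

definition partial_deriv :: "'n::finite \<Rightarrow> (real^'n \<Rightarrow> real) \<Rightarrow> real^'n \<Rightarrow> real" where
  "partial_deriv i f x = frechet_derivative f (at x) (axis i 1)"

definition grad :: "(real^'n::finite \<Rightarrow> real) \<Rightarrow> real^'n \<Rightarrow> real^'n" where
  "grad f x = (\<chi> i. partial_deriv i f x)"

definition hessian :: "(real^'n::finite \<Rightarrow> real) \<Rightarrow> real^'n \<Rightarrow> real^'n^'n" where
  "hessian f x = (\<chi> i j. partial_deriv i (partial_deriv j f) x)"

text \<open>\<open>Ck_on k f S\<close> is the class \<open>C\<^sup>k(S)\<close>; it is meant for open \<open>S\<close> only, since
  derivatives are taken in full neighbourhoods of the points of \<open>S\<close>.\<close>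

fun Ck_on :: "nat \<Rightarrow> (real^'n::finite \<Rightarrow> real) \<Rightarrow> (real^'n) set \<Rightarrow> bool" where
  "Ck_on 0 f S \<longleftrightarrow> continuous_on S f"
| "Ck_on (Suc k) f S \<longleftrightarrow>
     (\<forall>x\<in>S. f differentiable (at x)) \<and> (\<forall>i. Ck_on k (partial_deriv i f) S)"

definition test_function :: "(real^'n::finite) set \<Rightarrow> (real^'n \<Rightarrow> real) \<Rightarrow> bool" where
  "test_function S \<phi> \<longleftrightarrow>
     (\<forall>k. Ck_on k \<phi> UNIV) \<and> compact (closure {x. \<phi> x \<noteq> 0}) \<and> closure {x. \<phi> x \<noteq> 0} \<subseteq> S"

definition norm_D :: "(real^2 \<Rightarrow> real^2) \<Rightarrow> real^2 \<Rightarrow> real" where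
  "norm_D u x = sqrt ((norm (grad (\<lambda>y. u y $ 1) x))\<^sup>2 + (norm (grad (\<lambda>y. u y $ 2) x))\<^sup>2)"

text \<open>Weak solutions of the \<open>p\<close>-harmonic system of class \<open>C\<^sup>1\<close>, so that the weak gradients are the
  classical ones. Where \<open>Du = 0\<close>, the field \<open>|Du|\<^bsup>p-2\<^esup> \<nabla>u\<^sup>i\<close> is zero, also for \<open>p < 2\<close>,
  because \<open>0 powr a = 0\<close>; for \<open>p > 1\<close> this is its continuous extension. Integrability is
  demanded explicitly because the integral of a non-integrable function is zero by convention.\<close>

definition p_harmonic_map :: "real \<Rightarrow> (real^2) set \<Rightarrow> (real^2 \<Rightarrow> real^2) \<Rightarrow> bool" where
  "p_harmonic_map p \<Omega> u \<longleftrightarrow>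
     1 < p \<and>
     (\<forall>i. Ck_on 1 (\<lambda>x. u x $ i) \<Omega>) \<and>
     (\<forall>i \<phi>. test_function \<Omega> \<phi> \<longrightarrow>
        set_integrable lebesgue \<Omega>
          (\<lambda>x. (norm_D u x powr (p - 2) *\<^sub>R grad (\<lambda>y. u y $ i) x) \<bullet> grad \<phi> x) \<and>
        (LINT x:\<Omega>|lebesgue.
          (norm_D u x powr (p - 2) *\<^sub>R grad (\<lambda>y. u y $ i) x) \<bullet> grad \<phi> x) = 0)"

definition gauss_curvature :: "(real^2 \<Rightarrow> real) \<Rightarrow> real^2 \<Rightarrow> real" where
  "gauss_curvature v x =
     (hessian v x $ 1 $ 1 * hessian v x $ 2 $ 2 - (hessian v x $ 1 $ 2)\<^sup>2) /
     (1 + (partial_deriv 1 v x)\<^sup>2 + (partial_deriv 2 v x)\<^sup>2)\<^sup>2"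

end

theory Submission
  imports Defs
begin

text \<open>
  Put \<open>q = p - 2\<close> and suppose that at some point \<open>det H(u\<^sup>1) > 0\<close> while \<open>det H(u\<^sup>2) \<ge> 0\<close>. Where \<open>Du\<close>
  does not vanish, carrying out the divergence turns the system into
  \<open>|Du|\<^sup>2 \<Delta>u\<^sup>i + q \<nabla>u\<^sup>i \<bullet> (H(u\<^sup>1) \<nabla>u\<^sup>1 + H(u\<^sup>2) \<nabla>u\<^sup>2) = 0\<close> for \<open>i = 1, 2\<close>
  (lemma \<open>p_harmonic_jet_equation\<close>), which for given gradients is linear in the two Hessians.
  Changing the signs of the components, one may take both Hessians to have nonnegative trace, the
  first one positive. Since a symmetric planar matrix with nonnegative determinant differs from half
  its trace times the identity by a matrix of norm at most half its trace
  (\<open>inner_matrix_vector_trace_bound\<close>), every term of the system is controlled by the two Laplacians.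
  A suitable combination of the two equations with nonnegative weights then makes a positive
  quantity equal to zero (\<open>no_definite_jet\<close>). The weights are \<open>|\<nabla>u\<^sup>2|, |\<nabla>u\<^sup>1|\<close> for \<open>q \<ge> 0\<close> and
  \<open>|\<nabla>u\<^sup>1|, |\<nabla>u\<^sup>2|\<close> for \<open>q < 0\<close>, and the argument runs for \<open>-1 < q < 4\<close>, that is \<open>1 < p < 6\<close>, an
  interval that contains \<open>[4/3, 2 + sqrt 2]\<close>.

  Two analytic points remain. The map is only a weak solution, but its field is \<open>C\<^sup>1\<close> away from the
  zeros of \<open>Du\<close>, and testing with bumps shows that the divergence vanishes there pointwise
  (\<open>weakly_divergence_free_imp_divergence_free\<close>). At a zero \<open>x\<close> of \<open>Du\<close> the equation is empty; but it
  holds at \<open>x + t v\<close> for small \<open>t\<close>, and after division by \<open>t\<^sup>2\<close> the limit \<open>t \<rightarrow> 0\<close> is the same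
  algebraic relation with \<open>H(u\<^sup>i) v\<close> in place of \<open>\<nabla>u\<^sup>i\<close> (\<open>jet_equation_at_critical_point\<close>). As \<open>H(u\<^sup>1)\<close>
  is invertible, the algebraic argument applies to it as well.

  The statements on curvature follow because the numerator of \<open>K\<^sub>v\<close> is \<open>det H(v)\<close>, the Hessian
  of a \<open>C\<^sup>2\<close> function being symmetric (\<open>mixed_partial_derivs_commute\<close>).
\<close>

section \<open>Planar symmetric matrices and the equation at a point\<close>

lemma trace_2: "trace (A :: 'a::semiring_1^2^2) = A $ 1 $ 1 + A $ 2 $ 2"
  by (simp add: trace_def sum_2)

lemma symmetric_matrix_nth:
  assumes "transpose A = A"
  shows "A $ i $ j = A $ j $ i"
proof -
  have "transpose A $ i $ j = A $ j $ i" by (simp add: transpose_def)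
  then show ?thesis using assms by simp
qed

text \<open>Subtracting half the trace times the identity leaves a trace-free symmetric matrix. Its
  eigenvalues are opposite numbers, and a nonnegative determinant says exactly that their modulus is
  at most half the modulus of the trace. This turns sign information on the determinant into control
  of the bilinear form by the trace alone.\<close>

lemma inner_matrix_vector_trace_bound:
  fixes A :: "real^2^2"
  assumes sym: "transpose A = A" and det: "det A \<ge> 0"
  shows "\<bar>2 * (x \<bullet> (A *v y)) - trace A * (x \<bullet> y)\<bar> \<le> \<bar>trace A\<bar> * (norm x * norm y)"
proof -
  define a b d where "a = A $ 1 $ 1" and "b = A $ 1 $ 2" and "d = A $ 2 $ 2"
  have b': "A $ 2 $ 1 = b"
    unfolding b_def by (rule symmetric_matrix_nth[OF sym])
  have bb: "b\<^sup>2 \<le> a * d"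
    using det by (simp add: det_2 b' a_def d_def power2_eq_square flip: b_def)
  define P Q where "P = x $ 1 * y $ 1 - x $ 2 * y $ 2" and "Q = x $ 1 * y $ 2 + x $ 2 * y $ 1"
  have lhs: "2 * (x \<bullet> (A *v y)) - trace A * (x \<bullet> y) = (a - d) * P + (2 * b) * Q"
    by (simp add: trace_2 inner_vec_def sum_2 matrix_vector_mult_def b' P_def Q_def
        flip: a_def b_def d_def) (simp add: algebra_simps)
  have n: "(norm x * norm y)\<^sup>2 = P\<^sup>2 + Q\<^sup>2"
    unfolding P_def Q_def power_mult_distrib power2_norm_eq_inner inner_vec_def sum_2
    by (simp add: algebra_simps power2_eq_square)
  have "((a - d) * P + (2 * b) * Q)\<^sup>2 \<le> ((a - d)\<^sup>2 + (2 * b)\<^sup>2) * (P\<^sup>2 + Q\<^sup>2)"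
    using zero_le_power2[of "(a - d) * Q - (2 * b) * P"]
    by (simp add: algebra_simps power2_eq_square)
  also have "\<dots> \<le> (a + d)\<^sup>2 * (P\<^sup>2 + Q\<^sup>2)"
    using bb by (intro mult_right_mono) (simp_all add: power2_eq_square algebra_simps)
  also have "\<dots> = (\<bar>trace A\<bar> * (norm x * norm y))\<^sup>2"
    by (simp add: n[symmetric] trace_2 a_def d_def power_mult_distrib)
  finally show ?thesis
    unfolding lhs by (subst (asm) abs_le_square_iff[symmetric]) (simp add: abs_mult)
qed

lemma trace_nonzero_if_det_pos:
  fixes A :: "real^2^2"
  assumes "transpose A = A" "det A > 0"
  shows "trace A \<noteq> 0"
proof
  assume "trace A = 0"
  then have d: "A $ 2 $ 2 = - A $ 1 $ 1" by (simp add: trace_2)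
  have b': "A $ 2 $ 1 = A $ 1 $ 2"
    by (rule symmetric_matrix_nth[OF assms(1)])
  have "det A = - ((A $ 1 $ 1)\<^sup>2 + (A $ 1 $ 2)\<^sup>2)"
    by (simp add: det_2 b' d power2_eq_square)
  also have "\<dots> \<le> 0" by simp
  finally show False using assms(2) by simp
qed

text \<open>The \<open>i\<close>-th equation of the \<open>p\<close>-harmonic system in
  nondivergence form, with \<open>q = p - 2\<close>, as a relation between the gradients
  \<open>g\<close>, \<open>h\<close> and the Hessians \<open>A\<close>, \<open>B\<close> of the
  components at one point; \<open>g\<close> and \<open>A\<close> belong to the component whose
  divergence is taken. The factor \<open>|Du|\<^bsup>p-4\<^esup>\<close> is divided out, so that the
  relation makes sense, and holds trivially, where both gradients vanish.\<close>

definition jet_equation :: "real \<Rightarrow> real^'n::finite \<Rightarrow> real^'n \<Rightarrow> real^'n^'n \<Rightarrow> real^'n^'n \<Rightarrow> bool" where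
  "jet_equation q g h A B \<longleftrightarrow>
     ((norm g)\<^sup>2 + (norm h)\<^sup>2) * trace A + q * (g \<bullet> (A *v g + B *v h)) = 0"

text \<open>The system is linear in the pair of Hessians. A combination of its two equations with
  nonnegative weights tests the Hessians against \<open>k\<close>, the same combination of the
  gradients, and by the trace bound it dominates a positive multiple of a weighted sum of the
  traces. The weights have to depend on the sign of \<open>q\<close>; the two choices give the two
  constraints \<open>-1 < q\<close> and \<open>q < 4\<close>.\<close>

lemma no_definite_jet_of_nonneg_trace:
  fixes A B :: "real^2^2" and g h :: "real^2"
  assumes q: "-1 < q" "q < 4"
    and symA: "transpose A = A" and symB: "transpose B = B"
    and det: "det A \<ge> 0" "det B \<ge> 0"
    and tr: "trace A > 0" "trace B \<ge> 0"
    and nz: "g \<noteq> 0 \<or> h \<noteq> 0"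
    and eqs: "jet_equation q g h A B" "jet_equation q h g B A"
  shows False
proof -
  define a b S s t where "a = norm g" and "b = norm h" and "S = a\<^sup>2 + b\<^sup>2"
    and "s = trace A" and "t = trace B"
  have ab: "a \<ge> 0" "b \<ge> 0" and s: "s > 0" and t: "t \<ge> 0"
    using tr by (auto simp: a_def b_def s_def t_def)
  have S: "S > 0"
    using nz by (auto simp: S_def a_def b_def sum_power2_gt_zero_iff)
  have E1: "S * s + q * (g \<bullet> (A *v g) + g \<bullet> (B *v h)) = 0"
    and E2: "S * t + q * (h \<bullet> (A *v g) + h \<bullet> (B *v h)) = 0"
    using eqs by (simp_all add: jet_equation_def S_def a_def b_def s_def t_def inner_add_right
        add.commute)
  have bndA: "\<bar>2 * (k \<bullet> (A *v g)) - s * (k \<bullet> g)\<bar> \<le> s * (norm k * a)" for k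
    using inner_matrix_vector_trace_bound[OF symA det(1), of k g] s
    by (simp add: s_def a_def)
  have bndB: "\<bar>2 * (k \<bullet> (B *v h)) - t * (k \<bullet> h)\<bar> \<le> t * (norm k * b)" for k
    using inner_matrix_vector_trace_bound[OF symB det(2), of k h] t
    by (simp add: t_def b_def)
  have comb: "S * (\<alpha> * s + \<beta> * t)
      + q * (k \<bullet> (A *v g) + k \<bullet> (B *v h)) = 0"
    if "k = \<alpha> *\<^sub>R g + \<beta> *\<^sub>R h" for k \<alpha> \<beta>
  proof -
    have "\<alpha> * (S * s + q * (g \<bullet> (A *v g) + g \<bullet> (B *v h)))
        + \<beta> * (S * t + q * (h \<bullet> (A *v g) + h \<bullet> (B *v h))) = 0"
      using E1 E2 by simp
    then show ?thesis
      unfolding that by (simp add: inner_add_left algebra_simps)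
  qed
  have a_pos: "a > 0"
  proof (rule ccontr)
    assume "\<not> a > 0"
    then have "g = 0" using ab by (simp add: a_def)
    then show False using E1 S s by simp
  qed
  show False
  proof (cases "q < 0")
    case True
    \<comment> \<open>Here \<open>q\<close> is negative, so upper bounds on the quadratic terms are needed; with these weights
      \<open>|k|\<close> is at most \<open>S\<close> and the bound becomes \<open>S\<close> times the weighted sum of the traces.\<close>
    define k where "k = a *\<^sub>R g + b *\<^sub>R h"
    have nk: "norm k \<le> S"
      unfolding k_def S_def a_def b_def power2_eq_square
      by (rule norm_triangle_le) simp
    have kg: "k \<bullet> g \<le> S * a" and kh: "k \<bullet> h \<le> S * b"
      using norm_cauchy_schwarz[of k g] norm_cauchy_schwarz[of k h] nk ab
      by (auto simp: a_def b_def intro: order_trans[OF _ mult_right_mono])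
    have "norm k * a \<le> S * a" "norm k * b \<le> S * b"
      using nk ab by (auto intro: mult_right_mono)
    then have "s * (k \<bullet> g + norm k * a) \<le> s * (2 * (S * a))"
      and "t * (k \<bullet> h + norm k * b) \<le> t * (2 * (S * b))"
      using kg kh s t by (auto intro!: mult_left_mono)
    then have "k \<bullet> (A *v g) + k \<bullet> (B *v h) \<le> S * (a * s + b * t)"
      using bndA[of k] bndB[of k] by (simp add: algebra_simps abs_le_iff)
    then have "q * (k \<bullet> (A *v g) + k \<bullet> (B *v h)) \<ge> q * (S * (a * s + b * t))"
      using True by (simp add: mult_left_mono_neg)
    then have "S * (a * s + b * t) + q * (S * (a * s + b * t)) \<le> 0"
      using comb[OF k_def] by simp
    then have "(1 + q) * (S * (a * s + b * t)) \<le> 0"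
      by (simp add: algebra_simps)
    moreover have "a * s + b * t > 0"
      using a_pos s ab t by (simp add: add_pos_nonneg)
    ultimately show False
      using q S by (simp add: mult_le_0_iff)
  next
    case False
    then have q0: "q \<ge> 0" by simp
    show False
    proof (cases "b = 0")
      case True
      then have "h = 0" by (simp add: b_def)
      have "g \<bullet> (A *v g) \<ge> 0"
        using bndA[of g] by (simp add: a_def power2_eq_square dot_square_norm abs_le_iff)
      then have "S * s + q * (g \<bullet> (A *v g)) > 0"
        using S s q0 by (simp add: add_pos_nonneg)
      then show False
        using E1 \<open>h = 0\<close> by simp
    next
      case False
      then have b_pos: "b > 0" using ab by simp
      \<comment> \<open>The weights are exchanged so that the two summands of \<open>k\<close> have the same length \<open>a b\<close>. Then
        \<open>k\<close> bisects the angle between \<open>g\<close> and \<open>h\<close>, which gives the two formulas for \<open>|k|\<^sup>2\<close>, and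
        both lower bounds come from completing the square \<open>(|k| - a b)\<^sup>2\<close>.\<close>
      define k where "k = b *\<^sub>R g + a *\<^sub>R h"
      define n where "n = norm k"
      have gh: "g \<bullet> g = a\<^sup>2" "h \<bullet> h = b\<^sup>2"
        by (simp_all add: a_def b_def dot_square_norm)
      have n2: "n\<^sup>2 = 2 * b * (k \<bullet> g)" "n\<^sup>2 = 2 * a * (k \<bullet> h)"
        unfolding n_def power2_norm_eq_inner k_def
        by (simp_all add: inner_add_left inner_add_right gh inner_commute[of h g])
          (simp_all add: power2_eq_square algebra_simps)
      have lowA: "2 * (b * (k \<bullet> g) - b * (n * a)) \<ge> - (a * b)\<^sup>2"
        using n2 zero_le_power2[of "n - a * b"] by (simp add: power2_eq_square algebra_simps)
      have lowB: "2 * (a * (k \<bullet> h) - a * (n * b)) \<ge> - (a * b)\<^sup>2"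
        using n2 zero_le_power2[of "n - a * b"] by (simp add: power2_eq_square algebra_simps)
      have lowA': "2 * (k \<bullet> g - n * a) \<ge> - (a\<^sup>2 * b)"
      proof -
        have "b * (2 * (k \<bullet> g - n * a)) \<ge> b * (- (a\<^sup>2 * b))"
          using lowA by (simp add: power2_eq_square algebra_simps)
        then show ?thesis using mult_le_cancel_left_pos[OF b_pos] by blast
      qed
      have lowB': "2 * (k \<bullet> h - n * b) \<ge> - (b\<^sup>2 * a)"
      proof -
        have "a * (2 * (k \<bullet> h - n * b)) \<ge> a * (- (b\<^sup>2 * a))"
          using lowB by (simp add: power2_eq_square algebra_simps)
        then show ?thesis using mult_le_cancel_left_pos[OF a_pos] by blast
      qed
      have "s * (- (a\<^sup>2 * b)) \<le> s * (2 * (k \<bullet> g - n * a))"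
        using lowA' s by (intro mult_left_mono) auto
      also have "\<dots> \<le> 4 * (k \<bullet> (A *v g))"
        using bndA[of k] by (simp add: n_def abs_le_iff algebra_simps)
      finally have fA: "4 * (k \<bullet> (A *v g)) \<ge> - (s * a\<^sup>2 * b)" by (simp add: algebra_simps)
      have "t * (- (b\<^sup>2 * a)) \<le> t * (2 * (k \<bullet> h - n * b))"
        using lowB' t by (intro mult_left_mono) auto
      also have "\<dots> \<le> 4 * (k \<bullet> (B *v h))"
        using bndB[of k] by (simp add: n_def abs_le_iff algebra_simps)
      finally have fB: "4 * (k \<bullet> (B *v h)) \<ge> - (t * b\<^sup>2 * a)" by (simp add: algebra_simps)
      have "a\<^sup>2 * (s * b) \<le> S * (s * b)" "b\<^sup>2 * (t * a) \<le> S * (t * a)"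
        using s t ab by (auto simp: S_def intro!: mult_right_mono)
      then have "4 * (k \<bullet> (A *v g) + k \<bullet> (B *v h)) \<ge> - (S * (b * s + a * t))"
        using fA fB by (simp add: algebra_simps)
      then have "q * (4 * (k \<bullet> (A *v g) + k \<bullet> (B *v h))) \<ge> q * (- (S * (b * s + a * t)))"
        using q0 by (rule mult_left_mono)
      moreover have "4 * (S * (b * s + a * t)) + q * (4 * (k \<bullet> (A *v g) + k \<bullet> (B *v h))) = 0"
        using comb[OF k_def] by algebra
      ultimately have "4 * (S * (b * s + a * t)) + q * (- (S * (b * s + a * t))) \<le> 0"
        by linarith
      then have "(4 - q) * (S * (b * s + a * t)) \<le> 0"
        by (simp add: algebra_simps)
      moreover have "b * s + a * t > 0"
        using b_pos s ab t by (simp add: add_pos_nonneg)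
      ultimately show False
        using q S by (simp add: mult_le_0_iff)
    qed
  qed
qed

text \<open>The system is invariant under a change of sign of either component of the map.\<close>

lemma jet_equation_uminus:
  fixes A B :: "real^'n::finite^'n"
  shows "jet_equation q g h A B \<Longrightarrow> jet_equation q (- g) h (- A) B"
    and "jet_equation q g h A B \<Longrightarrow> jet_equation q g (- h) A (- B)"
proof -
  have m: "(- M) *v (- v) = M *v v" "trace (- M) = - trace M" for M :: "real^'n^'n" and v
    by (simp_all add: vec_eq_iff matrix_vector_mult_def trace_def sum_negf)
  show "jet_equation q g h A B \<Longrightarrow> jet_equation q (- g) h (- A) B"
    "jet_equation q g h A B \<Longrightarrow> jet_equation q g (- h) A (- B)"
    by (simp_all add: jet_equation_def m inner_minus_left algebra_simps)
qed

text \<open>Changing signs of the components reduces this to nonnegative traces, and a positive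
  determinant excludes a zero trace.\<close>

lemma no_definite_jet:
  fixes A B :: "real^2^2" and g h :: "real^2"
  assumes q: "-1 < q" "q < 4"
    and sym: "transpose A = A" "transpose B = B"
    and det: "det A > 0" "det B \<ge> 0"
    and nz: "g \<noteq> 0 \<or> h \<noteq> 0"
    and eqs: "jet_equation q g h A B" "jet_equation q h g B A"
  shows False
proof -
  have flip: "transpose (- M) = - transpose M" "det (- M) = det M" "trace (- M) = - trace M"
    for M :: "real^2^2"
    by (simp_all add: transpose_def vec_eq_iff det_2 trace_2)
  have pos: False
    if "trace A > 0" and sA: "transpose A = A" "det A > 0" and nz: "g \<noteq> 0 \<or> h \<noteq> 0"
      and e: "jet_equation q g h A B" "jet_equation q h g B A" for A g
  proof (cases "trace B \<ge> 0")
    case True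
    then show False
      using no_definite_jet_of_nonneg_trace[OF q sA(1) sym(2) _ det(2) that(1) _ nz e] sA(2)
      by simp
  next
    case False
    then show False
      using no_definite_jet_of_nonneg_trace[OF q sA(1), of "- B" g "- h"] sA(2) that(1) nz
        jet_equation_uminus(2)[OF e(1)] jet_equation_uminus(1)[OF e(2)] sym(2) det(2)
      by (simp add: flip)
  qed
  show False
  proof (cases "trace A > 0")
    case True
    then show False using pos sym(1) det(1) nz eqs by blast
  next
    case False
    then have "trace (- A) > 0"
      using trace_nonzero_if_det_pos[OF sym(1) det(1)] by (simp add: flip)
    then show False
      using pos[of "- A" "- g"] sym(1) det(1) nz
        jet_equation_uminus(1)[OF eqs(1)] jet_equation_uminus(2)[OF eqs(2)]
      by (simp add: flip)
  qed
qed

section \<open>Calculus of partial derivatives\<close>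

lemma partial_deriv_eqI:
  "(f has_derivative D) (at x) \<Longrightarrow> partial_deriv i f x = D (axis i 1)"
  by (simp add: partial_deriv_def frechet_derivative_at[symmetric])

lemma has_derivative_grad:
  fixes f :: "real^'n::finite \<Rightarrow> real"
  assumes "f differentiable (at x)"
  shows "(f has_derivative (\<lambda>v. grad f x \<bullet> v)) (at x)"
proof -
  let ?D = "frechet_derivative f (at x)"
  have D: "(f has_derivative ?D) (at x)"
    using assms frechet_derivative_works by blast
  then have lin: "linear ?D"
    by (simp add: has_derivative_linear)
  have "?D v = grad f x \<bullet> v" for v
  proof -
    have "?D v = ?D (\<Sum>i\<in>UNIV. v $ i *s axis i 1)"
      by (simp only: basis_expansion)
    also have "\<dots> = grad f x \<bullet> v"
      by (simp add: linear_sum[OF lin] linear_scale[OF lin] scalar_mult_eq_scaleR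
          inner_vec_def grad_def partial_deriv_def mult.commute)
    finally show ?thesis .
  qed
  then show ?thesis using D by (metis (no_types, lifting) ext)
qed

lemma partial_deriv_add:
  "f differentiable (at x) \<Longrightarrow> g differentiable (at x) \<Longrightarrow>
    partial_deriv i (\<lambda>y. f y + g y) x = partial_deriv i f x + partial_deriv i g x"
  by (rule trans[OF partial_deriv_eqI[OF has_derivative_add]])
    (auto simp: partial_deriv_def frechet_derivative_works[symmetric])

lemma partial_deriv_diff:
  "f differentiable (at x) \<Longrightarrow> g differentiable (at x) \<Longrightarrow>
    partial_deriv i (\<lambda>y. f y - g y) x = partial_deriv i f x - partial_deriv i g x"
  by (rule trans[OF partial_deriv_eqI[OF has_derivative_diff]])
    (auto simp: partial_deriv_def frechet_derivative_works[symmetric])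

lemma partial_deriv_mult:
  "f differentiable (at x) \<Longrightarrow> g differentiable (at x) \<Longrightarrow>
    partial_deriv i (\<lambda>y. f y * g y) x = f x * partial_deriv i g x + partial_deriv i f x * g x"
  by (rule trans[OF partial_deriv_eqI[OF has_derivative_mult]])
    (auto simp: partial_deriv_def frechet_derivative_works[symmetric])

lemma partial_deriv_const: "partial_deriv i (\<lambda>y. c) x = 0"
  by (rule trans[OF partial_deriv_eqI[OF has_derivative_const]]) simp

lemma partial_deriv_coord: "partial_deriv i (\<lambda>y. y $ k) x = (if i = k then 1 else 0)"
  by (rule trans[OF partial_deriv_eqI[OF bounded_linear_imp_has_derivative[OF bounded_linear_vec_nth]]])
    (simp add: axis_def)

lemma partial_deriv_sum:
  assumes "finite I" "\<And>k. k \<in> I \<Longrightarrow> f k differentiable (at x)"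
  shows "partial_deriv i (\<lambda>y. \<Sum>k\<in>I. f k y) x = (\<Sum>k\<in>I. partial_deriv i (f k) x)"
  by (rule trans[OF partial_deriv_eqI[OF has_derivative_sum]])
    (use assms in \<open>auto simp: partial_deriv_def frechet_derivative_works[symmetric]\<close>)

lemma partial_deriv_chain:
  assumes "f differentiable (at x)" "(\<phi> has_real_derivative d) (at (f x))"
  shows "partial_deriv i (\<lambda>y. \<phi> (f y)) x = d * partial_deriv i f x"
    and "(\<lambda>y. \<phi> (f y)) differentiable (at x)"
proof -
  have "((\<lambda>y. \<phi> (f y)) has_derivative (\<lambda>v. d * frechet_derivative f (at x) v)) (at x)"
    using assms(1) unfolding frechet_derivative_works
    by (rule has_derivative_compose[where g = \<phi>])
      (use assms(2) in \<open>simp add: has_field_derivative_def\<close>)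
  then show "partial_deriv i (\<lambda>y. \<phi> (f y)) x = d * partial_deriv i f x"
    "(\<lambda>y. \<phi> (f y)) differentiable (at x)"
    by (auto simp: partial_deriv_eqI differentiable_def) (simp add: partial_deriv_def)
qed

lemma partial_deriv_cong_open:
  assumes "open S" "x \<in> S" "\<And>y. y \<in> S \<Longrightarrow> f y = g y" "f differentiable (at x)"
  shows "partial_deriv i f x = partial_deriv i g x" "g differentiable (at x)"
  using assms frechet_derivative_transform_within_open[OF assms(4,1,2)]
    has_derivative_transform_within_open[OF _ assms(1,2)]
  unfolding partial_deriv_def differentiable_def by metis+

lemma derivative_along_line:
  fixes f :: "real^'n::finite \<Rightarrow> real"
  assumes "f differentiable (at (x + t *\<^sub>R v))"
  shows "((\<lambda>s. f (x + s *\<^sub>R v)) has_real_derivative grad f (x + t *\<^sub>R v) \<bullet> v) (at t)"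
proof -
  have "((\<lambda>s. x + s *\<^sub>R v) has_derivative (\<lambda>s. s *\<^sub>R v)) (at t)"
    by (auto intro!: derivative_eq_intros)
  from has_derivative_compose[OF this has_derivative_grad[OF assms]]
  show ?thesis
    by (simp add: has_field_derivative_def mult_commute_abs)
qed

lemma grad_axis: "grad f x \<bullet> axis i 1 = partial_deriv i f x"
  by (simp add: grad_def inner_axis)

lemma mean_value_along_axis:
  fixes f :: "real^'n::finite \<Rightarrow> real"
  assumes "0 < t" "\<And>s. 0 \<le> s \<Longrightarrow> s \<le> t \<Longrightarrow> f differentiable (at (x + s *\<^sub>R axis i 1))"
  obtains s where "0 < s" "s < t"
    "f (x + t *\<^sub>R axis i 1) - f x = t * partial_deriv i f (x + s *\<^sub>R axis i 1)"
  using MVT2[OF assms(1), of "\<lambda>s. f (x + s *\<^sub>R axis i 1)"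
      "\<lambda>s. partial_deriv i f (x + s *\<^sub>R axis i 1)"]
    derivative_along_line[OF assms(2)]
  by (auto simp: grad_axis)

lemma Ck_on_subset: "Ck_on k f S \<Longrightarrow> T \<subseteq> S \<Longrightarrow> Ck_on k f T"
  by (induction k arbitrary: f) (auto intro: continuous_on_subset)

lemma Ck_on_1_imp: 
  assumes "Ck_on 1 f S"
  shows "x \<in> S \<Longrightarrow> f differentiable (at x)" "continuous_on S (partial_deriv i f)"
  using assms by (auto simp: One_nat_def)

lemma Ck_on_1I:
  assumes "\<And>x. x \<in> S \<Longrightarrow> f differentiable (at x)"
    and "\<And>i. continuous_on S (\<lambda>x. d i x)"
    and "\<And>i x. x \<in> S \<Longrightarrow> partial_deriv i f x = d i x"
  shows "Ck_on 1 f S"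
proof -
  have "continuous_on S (partial_deriv i f)" for i
    using assms(2)[of i] by (subst continuous_on_cong[OF refl assms(3)])
  then show ?thesis
    using assms(1) by (simp add: One_nat_def)
qed

lemma Ck_on_1_continuous: "Ck_on 1 f S \<Longrightarrow> continuous_on S f"
  using Ck_on_1_imp(1)
  by (auto intro!: continuous_at_imp_continuous_on differentiable_imp_continuous_within)

lemma Ck_on_1_add:
  assumes f: "Ck_on 1 f S" and g: "Ck_on 1 g S"
  shows "Ck_on 1 (\<lambda>x. f x + g x) S"
proof (rule Ck_on_1I)
  note d = Ck_on_1_imp(1)[OF f] Ck_on_1_imp(1)[OF g]
  show "(\<lambda>x. f x + g x) differentiable (at x)" if "x \<in> S" for x
    using d that by (intro differentiable_add) auto
  show "partial_deriv i (\<lambda>x. f x + g x) x = partial_deriv i f x + partial_deriv i g x"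
    if "x \<in> S" for i x
    using d that by (intro partial_deriv_add) auto
  show "continuous_on S (\<lambda>x. partial_deriv i f x + partial_deriv i g x)" for i
    by (intro continuous_on_add Ck_on_1_imp(2)[OF f] Ck_on_1_imp(2)[OF g])
qed

lemma Ck_on_1_sum:
  assumes "finite I" "\<And>k. k \<in> I \<Longrightarrow> Ck_on 1 (f k) S"
  shows "Ck_on 1 (\<lambda>x. \<Sum>k\<in>I. f k x) S"
proof (rule Ck_on_1I)
  note d = Ck_on_1_imp(1)[OF assms(2)]
  show "(\<lambda>x. \<Sum>k\<in>I. f k x) differentiable (at x)" if "x \<in> S" for x
    using assms(1) d that by (intro differentiable_sum) auto
  show "partial_deriv i (\<lambda>x. \<Sum>k\<in>I. f k x) x = (\<Sum>k\<in>I. partial_deriv i (f k) x)"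
    if "x \<in> S" for i x
    using assms(1) d that by (intro partial_deriv_sum) auto
  show "continuous_on S (\<lambda>x. \<Sum>k\<in>I. partial_deriv i (f k) x)" for i
    by (intro continuous_on_sum Ck_on_1_imp(2)[OF assms(2)])
qed

lemma Ck_on_1_mult:
  assumes f: "Ck_on 1 f S" and g: "Ck_on 1 g S"
  shows "Ck_on 1 (\<lambda>x. f x * g x) S"
proof (rule Ck_on_1I)
  note d = Ck_on_1_imp(1)[OF f] Ck_on_1_imp(1)[OF g]
  show "(\<lambda>x. f x * g x) differentiable (at x)" if "x \<in> S" for x
    using d that by (intro differentiable_mult) auto
  show "partial_deriv i (\<lambda>x. f x * g x) x = f x * partial_deriv i g x + partial_deriv i f x * g x"
    if "x \<in> S" for i x
    using d that by (intro partial_deriv_mult) auto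
  show "continuous_on S (\<lambda>x. f x * partial_deriv i g x + partial_deriv i f x * g x)" for i
    by (intro continuous_intros Ck_on_1_continuous[OF f] Ck_on_1_continuous[OF g]
        Ck_on_1_imp(2)[OF f] Ck_on_1_imp(2)[OF g])
qed

lemma Ck_on_1_powr:
  assumes f: "Ck_on 1 f S" and pos: "\<And>x. x \<in> S \<Longrightarrow> f x > 0"
  shows "Ck_on 1 (\<lambda>x. f x powr a) S"
    and "\<And>x i. x \<in> S \<Longrightarrow> partial_deriv i (\<lambda>x. f x powr a) x = a * f x powr (a - 1) * partial_deriv i f x"
proof -
  have D: "((\<lambda>y. y powr a) has_real_derivative a * f x powr (a - 1)) (at (f x))" if "x \<in> S" for x
    using pos[OF that] by (rule has_real_derivative_powr)
  note chain = partial_deriv_chain[OF Ck_on_1_imp(1)[OF f] D]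
  show pd: "partial_deriv i (\<lambda>x. f x powr a) x = a * f x powr (a - 1) * partial_deriv i f x"
    if "x \<in> S" for x i
    using that that by (rule chain(1))
  show "Ck_on 1 (\<lambda>x. f x powr a) S"
  proof (rule Ck_on_1I[OF _ _ pd])
    show "(\<lambda>x. f x powr a) differentiable (at x)" if "x \<in> S" for x
      using that that by (rule chain(2))
    show "continuous_on S (\<lambda>x. a * f x powr (a - 1) * partial_deriv i f x)" for i
      using pos by (intro continuous_intros Ck_on_1_continuous[OF f] Ck_on_1_imp(2)[OF f]) force
  qed
qed

lemma Ck_on_2_partial: "Ck_on 2 f S \<Longrightarrow> Ck_on 1 (partial_deriv i f) S"
  by (simp add: numeral_2_eq_2)

lemma Ck_on_2_1: "Ck_on 2 f S \<Longrightarrow> Ck_on 1 f S"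
  by (auto simp: numeral_2_eq_2 intro!: continuous_at_imp_continuous_on
      differentiable_imp_continuous_within)

section \<open>Symmetry of the Hessian\<close>

text \<open>Two applications of the mean value theorem, first along axis \<open>i\<close> and then
  along axis \<open>j\<close>, express the second difference by the mixed derivative at a nearby
  point.\<close>

lemma second_difference_quotient:
  fixes f :: "real^'n::finite \<Rightarrow> real"
  assumes "open S" "x \<in> S" "Ck_on 2 f S" "e > 0"
  shows "\<exists>d>0. \<forall>t. 0 < t \<and> t < d \<longrightarrow>
    \<bar>f (x + t *\<^sub>R axis i 1 + t *\<^sub>R axis j 1) - f (x + t *\<^sub>R axis i 1) - f (x + t *\<^sub>R axis j 1) + f x
      - t\<^sup>2 * partial_deriv j (partial_deriv i f) x\<bar> \<le> e * t\<^sup>2"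
proof -
  let ?H = "partial_deriv j (partial_deriv i f)"
  have "continuous_on S ?H"
    using Ck_on_1_imp(2)[OF Ck_on_2_partial[OF assms(3)]] .
  then have "isCont ?H x"
    using assms(1,2) continuous_on_eq_continuous_at by blast
  then obtain d1 where d1: "d1 > 0" "\<And>y. dist y x < d1 \<Longrightarrow> \<bar>?H y - ?H x\<bar> < e"
    using assms(4) unfolding continuous_at_eps_delta dist_real_def by blast
  obtain d2 where d2: "d2 > 0" "ball x d2 \<subseteq> S"
    using assms(1,2) open_contains_ball by blast
  define d where "d = min d1 d2 / 2"
  have near: "dist (x + s *\<^sub>R axis i 1 + r *\<^sub>R axis j 1) x < min d1 d2"
    if "0 \<le> s" "s < d" "0 \<le> r" "r < d" for s r
  proof -
    have "norm (s *\<^sub>R axis i (1::real) + r *\<^sub>R axis j 1) \<le> s + r"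
      using that by (intro norm_triangle_le) (simp)
    then show ?thesis
      using that by (simp add: dist_norm d_def add.assoc)
  qed
  have inS: "x + s *\<^sub>R axis i 1 + r *\<^sub>R axis j 1 \<in> S"
    if "0 \<le> s" "s < d" "0 \<le> r" "r < d" for s r
    using near[OF that] d2(2) by (auto simp: dist_commute)
  have df: "f differentiable (at y)" if "y \<in> S" for y
    using Ck_on_1_imp(1)[OF Ck_on_2_1[OF assms(3)]] that .
  have dfi: "partial_deriv i f differentiable (at y)" if "y \<in> S" for y
    using Ck_on_1_imp(1)[OF Ck_on_2_partial[OF assms(3)]] that .
  have "\<bar>f (x + t *\<^sub>R axis i 1 + t *\<^sub>R axis j 1) - f (x + t *\<^sub>R axis i 1)
      - f (x + t *\<^sub>R axis j 1) + f x - t\<^sup>2 * ?H x\<bar> \<le> e * t\<^sup>2"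
    if t: "0 < t" "t < d" for t
  proof -
    define g where "g = (\<lambda>y. f (y + t *\<^sub>R axis j 1) - f y)"
    have shift: "(\<lambda>z. f (z + t *\<^sub>R axis j 1)) differentiable (at y)"
      "partial_deriv i (\<lambda>z. f (z + t *\<^sub>R axis j 1)) y = partial_deriv i f (y + t *\<^sub>R axis j 1)"
      if "f differentiable (at (y + t *\<^sub>R axis j 1))" for y
    proof -
      have "((\<lambda>z. z + t *\<^sub>R axis j 1) has_derivative (\<lambda>v. v)) (at y)"
        by (auto intro!: derivative_eq_intros)
      from has_derivative_compose[OF this has_derivative_grad[OF that]]
      show "(\<lambda>z. f (z + t *\<^sub>R axis j 1)) differentiable (at y)"
        "partial_deriv i (\<lambda>z. f (z + t *\<^sub>R axis j 1)) y = partial_deriv i f (y + t *\<^sub>R axis j 1)"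
        by (auto simp: differentiable_def partial_deriv_eqI grad_axis)
    qed
    have dg: "g differentiable (at (x + s *\<^sub>R axis i 1))"
      "partial_deriv i g (x + s *\<^sub>R axis i 1) =
        partial_deriv i f (x + s *\<^sub>R axis i 1 + t *\<^sub>R axis j 1) - partial_deriv i f (x + s *\<^sub>R axis i 1)"
      if "0 \<le> s" "s \<le> t" for s
    proof -
      have *: "f differentiable (at (x + s *\<^sub>R axis i 1 + t *\<^sub>R axis j 1))"
        "f differentiable (at (x + s *\<^sub>R axis i 1))"
        using inS[of s t] inS[of s 0] that t by (auto intro!: df)
      then show "g differentiable (at (x + s *\<^sub>R axis i 1))"
        unfolding g_def by (intro differentiable_diff shift)
      show "partial_deriv i g (x + s *\<^sub>R axis i 1) =
        partial_deriv i f (x + s *\<^sub>R axis i 1 + t *\<^sub>R axis j 1) - partial_deriv i f (x + s *\<^sub>R axis i 1)"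
        unfolding g_def using * by (simp add: partial_deriv_diff shift)
    qed
    obtain s where s: "0 < s" "s < t"
      "g (x + t *\<^sub>R axis i 1) - g x = t * partial_deriv i g (x + s *\<^sub>R axis i 1)"
      using mean_value_along_axis[OF t(1) dg(1)] by blast
    obtain r where r: "0 < r" "r < t"
      "partial_deriv i f (x + s *\<^sub>R axis i 1 + t *\<^sub>R axis j 1) - partial_deriv i f (x + s *\<^sub>R axis i 1)
        = t * ?H (x + s *\<^sub>R axis i 1 + r *\<^sub>R axis j 1)"
      by (rule mean_value_along_axis[OF t(1), of "partial_deriv i f" "x + s *\<^sub>R axis i 1" j])
        (use s t in \<open>auto intro!: dfi inS\<close>)
    have "f (x + t *\<^sub>R axis i 1 + t *\<^sub>R axis j 1) - f (x + t *\<^sub>R axis i 1)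
        - f (x + t *\<^sub>R axis j 1) + f x = t\<^sup>2 * ?H (x + s *\<^sub>R axis i 1 + r *\<^sub>R axis j 1)"
      using s(3) dg(2)[of s] r(3) s(1,2) by (simp add: g_def power2_eq_square)
    moreover have "\<bar>?H (x + s *\<^sub>R axis i 1 + r *\<^sub>R axis j 1) - ?H x\<bar> \<le> e"
      using near[of s r] s r t by (intro less_imp_le d1(2)) auto
    ultimately show ?thesis
      by (simp add: right_diff_distrib[symmetric] abs_mult mult.commute[of e] mult_left_mono)
  qed
  moreover have "d > 0" using d1 d2 by (simp add: d_def)
  ultimately show ?thesis by blast
qed

text \<open>The second difference does not change when the two axes are exchanged.\<close>

lemma mixed_partial_derivs_commute:
  fixes f :: "real^'n::finite \<Rightarrow> real"
  assumes "open S" "x \<in> S" "Ck_on 2 f S"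
  shows "partial_deriv i (partial_deriv j f) x = partial_deriv j (partial_deriv i f) x"
proof -
  let ?a = "partial_deriv j (partial_deriv i f) x" and ?b = "partial_deriv i (partial_deriv j f) x"
  have "\<bar>?a - ?b\<bar> \<le> 0 + e" if "e > 0" for e
  proof -
    obtain d1 where d1: "d1 > 0" "\<And>t. 0 < t \<Longrightarrow> t < d1 \<Longrightarrow>
      \<bar>f (x + t *\<^sub>R axis i 1 + t *\<^sub>R axis j 1) - f (x + t *\<^sub>R axis i 1) - f (x + t *\<^sub>R axis j 1) + f x
      - t\<^sup>2 * ?a\<bar> \<le> e / 2 * t\<^sup>2"
      using second_difference_quotient[OF assms, of "e / 2" i j] \<open>e > 0\<close> by auto
    obtain d2 where d2: "d2 > 0" "\<And>t. 0 < t \<Longrightarrow> t < d2 \<Longrightarrow>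
      \<bar>f (x + t *\<^sub>R axis j 1 + t *\<^sub>R axis i 1) - f (x + t *\<^sub>R axis j 1) - f (x + t *\<^sub>R axis i 1) + f x
      - t\<^sup>2 * ?b\<bar> \<le> e / 2 * t\<^sup>2"
      using second_difference_quotient[OF assms, of "e / 2" j i] \<open>e > 0\<close> by auto
    define t where "t = min d1 d2 / 2"
    have t: "0 < t" "t < d1" "t < d2"
      using d1(1) d2(1) by (auto simp: t_def)
    have "x + t *\<^sub>R axis i 1 + t *\<^sub>R axis j 1 = x + t *\<^sub>R axis j 1 + t *\<^sub>R axis i 1"
      by (simp add: algebra_simps)
    then have "\<bar>t\<^sup>2 * ?a - t\<^sup>2 * ?b\<bar> \<le> t\<^sup>2 * e"
      using d1(2)[OF t(1,2)] d2(2)[OF t(1,3)]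
      by (simp only: mult.commute[of "e / 2"] times_divide_eq_right)
    then have "t\<^sup>2 * \<bar>?a - ?b\<bar> \<le> t\<^sup>2 * e"
      by (simp add: right_diff_distrib[symmetric] abs_mult)
    then show ?thesis
      using t(1) by (simp add: mult_le_cancel_left_pos)
  qed
  then have "\<bar>?a - ?b\<bar> \<le> 0" by (rule field_le_epsilon)
  then show ?thesis by simp
qed

lemma hessian_symmetric:
  fixes f :: "real^'n::finite \<Rightarrow> real"
  assumes "open S" "x \<in> S" "Ck_on 2 f S"
  shows "transpose (hessian f x) = hessian f x"
  using mixed_partial_derivs_commute[OF assms]
  by (simp add: hessian_def transpose_def vec_eq_iff)

section \<open>Smooth bumps\<close>

text \<open>The derivatives of \<open>exp (-1/t)\<close>, extended by zero, are integer combinations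
  of these functions, which is why the whole family is treated at once.\<close>

definition flat_exp :: "nat \<Rightarrow> real \<Rightarrow> real" where
  "flat_exp m t = (if t > 0 then exp (- (1 / t)) / t ^ m else 0)"

lemma flat_exp_tendsto_0: "((\<lambda>t. exp (- (1 / t)) / t ^ m) \<longlongrightarrow> (0::real)) (at_right 0)"
proof -
  have "((\<lambda>t::real. inverse t ^ m / exp (inverse t)) \<longlongrightarrow> 0) (at_right 0)"
    by (rule filterlim_compose[OF tendsto_power_div_exp_0 filterlim_inverse_at_top_right])
  then show ?thesis
    by (simp add: exp_minus field_simps)
qed

lemma flat_exp_has_real_derivative:
  "(flat_exp m has_real_derivative flat_exp (m + 2) t - m * flat_exp (m + 1) t) (at t)"
proof -
  consider "t > 0" | "t < 0" | "t = 0" by linarith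
  then show ?thesis
  proof cases
    case 1
    have "((\<lambda>t. exp (- (1 / t)) / t ^ m) has_real_derivative
        flat_exp (m + 2) t - m * flat_exp (m + 1) t) (at t)"
    proof -
      have "((\<lambda>t. exp (- (1 / t)) / t ^ m) has_real_derivative
          (exp (- (1 / t)) * (1 / t\<^sup>2) * t ^ m - exp (- (1 / t)) * (m * t ^ (m - 1))) / (t ^ m * t ^ m)) (at t)"
        using 1 by (auto intro!: derivative_eq_intros simp: power2_eq_square)
      moreover have "(exp (- (1 / t)) * (1 / t\<^sup>2) * t ^ m - exp (- (1 / t)) * (m * t ^ (m - 1))) / (t ^ m * t ^ m)
          = flat_exp (m + 2) t - m * flat_exp (m + 1) t"
        using 1 by (cases m) (simp_all add: flat_exp_def field_simps power2_eq_square)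
      ultimately show ?thesis by simp
    qed
    then show ?thesis
      by (rule has_field_derivative_transform_within_open[where S = "{0<..}"])
        (use 1 in \<open>auto simp: flat_exp_def\<close>)
  next
    case 2
    have "((\<lambda>t. 0) has_real_derivative flat_exp (m + 2) t - m * flat_exp (m + 1) t) (at t)"
      using 2 by (auto simp: flat_exp_def)
    then show ?thesis
      by (rule has_field_derivative_transform_within_open[where S = "{..<0}"])
        (use 2 in \<open>auto simp: flat_exp_def\<close>)
  next
    case 3
    \<comment> \<open>At the origin the difference quotient from the right is \<open>flat_exp (m + 1)\<close> itself.\<close>
    have "((\<lambda>h. flat_exp m h / h) \<longlongrightarrow> 0) (at_right 0)"
    proof (rule Lim_transform_eventually[OF flat_exp_tendsto_0[of "m + 1"]])
      show "\<forall>\<^sub>F t in at_right 0. exp (- (1 / t)) / t ^ (m + 1) = flat_exp m t / t"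
        using eventually_at_right_less[of 0] by eventually_elim (simp add: flat_exp_def field_simps)
    qed
    moreover have "((\<lambda>h. flat_exp m h / h) \<longlongrightarrow> 0) (at_left 0)"
    proof (rule Lim_transform_eventually[OF tendsto_const])
      show "\<forall>\<^sub>F t in at_left 0. 0 = flat_exp m t / t"
        by (auto simp: eventually_at_filter flat_exp_def intro!: always_eventually)
    qed
    ultimately have "((\<lambda>h. flat_exp m h / h) \<longlongrightarrow> 0) (at 0)"
      by (rule filterlim_split_at_real[rotated])
    then show ?thesis
      using 3 by (simp add: has_field_derivative_iff flat_exp_def)
  qed
qed

text \<open>An algebra of functions that contains the standard bump on a ball and is closed under
  partial differentiation. Smoothness of all its members then follows by induction on the order,
  without any formula for higher derivatives.\<close>

inductive_set bump_algebra :: "real^'n::finite \<Rightarrow> real \<Rightarrow> (real^'n \<Rightarrow> real) set"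
  for c :: "real^'n::finite" and r :: real
  where
    bump: "(\<lambda>x. flat_exp m (r\<^sup>2 - (norm (x - c))\<^sup>2)) \<in> bump_algebra c r"
  | const: "(\<lambda>x. a) \<in> bump_algebra c r"
  | coord: "(\<lambda>x. x $ i) \<in> bump_algebra c r"
  | add: "f \<in> bump_algebra c r \<Longrightarrow> g \<in> bump_algebra c r \<Longrightarrow> (\<lambda>x. f x + g x) \<in> bump_algebra c r"
  | mult: "f \<in> bump_algebra c r \<Longrightarrow> g \<in> bump_algebra c r \<Longrightarrow> (\<lambda>x. f x * g x) \<in> bump_algebra c r"

lemma partial_deriv_radius:
  fixes c :: "real^'n::finite"
  shows "(\<lambda>x. r\<^sup>2 - (norm (x - c))\<^sup>2) differentiable (at x)"
    and "partial_deriv i (\<lambda>x. r\<^sup>2 - (norm (x - c))\<^sup>2) x = -2 * (x $ i - c $ i)"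
proof -
  have "((\<lambda>x. r\<^sup>2 - (x - c) \<bullet> (x - c)) has_derivative (\<lambda>v. - ((x - c) \<bullet> v + v \<bullet> (x - c)))) (at x)"
    by (auto intro!: derivative_eq_intros)
  then show "(\<lambda>x. r\<^sup>2 - (norm (x - c))\<^sup>2) differentiable (at x)"
    "partial_deriv i (\<lambda>x. r\<^sup>2 - (norm (x - c))\<^sup>2) x = -2 * (x $ i - c $ i)"
    unfolding power2_norm_eq_inner
    by (auto simp: differentiable_def partial_deriv_eqI inner_axis inner_axis' algebra_simps)
qed

lemma bump_algebra_closed:
  "f \<in> bump_algebra c r \<Longrightarrow> (\<forall>x. f differentiable (at x)) \<and> (\<forall>i. partial_deriv i f \<in> bump_algebra c r)"
proof (induction rule: bump_algebra.induct)
  case (bump m)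
  let ?s = "\<lambda>x. r\<^sup>2 - (norm (x - c))\<^sup>2"
  have pd: "partial_deriv i (\<lambda>x. flat_exp m (?s x)) =
      (\<lambda>x. (flat_exp (m + 2) (?s x) + (- real m) * flat_exp (m + 1) (?s x)) * (-2 * (x $ i + (- c $ i))))" for i
    by (rule ext) (simp add: partial_deriv_chain(1)[OF partial_deriv_radius(1) flat_exp_has_real_derivative]
        partial_deriv_radius(2))
  have "partial_deriv i (\<lambda>x. flat_exp m (?s x)) \<in> bump_algebra c r" for i
    unfolding pd by (intro bump_algebra.intros)
  then show ?case
    using partial_deriv_chain(2)[OF partial_deriv_radius(1) flat_exp_has_real_derivative] by blast
next
  case (const a)
  have "partial_deriv i (\<lambda>x. a) = (\<lambda>x::real^'a. 0)" for i :: 'a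
    by (rule ext) (rule partial_deriv_const)
  then show ?case by (auto intro: bump_algebra.const)
next
  case (coord k)
  have "partial_deriv i (\<lambda>x. x $ k) = (\<lambda>x. if i = k then 1 else 0)" for i
    by (rule ext) (rule partial_deriv_coord)
  then show ?case
    by (auto intro: bump_algebra.const bounded_linear_imp_differentiable bounded_linear_vec_nth)
next
  case (add f g)
  then have "partial_deriv i (\<lambda>x. f x + g x) = (\<lambda>x. partial_deriv i f x + partial_deriv i g x)" for i
    by (intro ext partial_deriv_add) auto
  then show ?case using add by (auto intro: bump_algebra.add)
next
  case (mult f g)
  then have "partial_deriv i (\<lambda>x. f x * g x)
      = (\<lambda>x. f x * partial_deriv i g x + partial_deriv i f x * g x)" for i
    by (intro ext partial_deriv_mult) auto
  then show ?case using mult by (auto intro!: bump_algebra.add bump_algebra.mult)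
qed

lemma bump_algebra_smooth: "f \<in> bump_algebra c r \<Longrightarrow> Ck_on k f UNIV"
proof (induction k arbitrary: f)
  case 0
  then show ?case
    using bump_algebra_closed[OF 0]
    by (auto intro!: continuous_at_imp_continuous_on differentiable_imp_continuous_within)
next
  case (Suc k)
  then show ?case using bump_algebra_closed[OF Suc.prems] by auto
qed

lemma obtain_test_function:
  fixes c :: "real^'n::finite"
  assumes "0 < r" "cball c r \<subseteq> S"
  obtains \<phi> where "test_function S \<phi>" "\<And>x. \<phi> x \<ge> 0" "\<And>x. \<phi> x > 0 \<longleftrightarrow> x \<in> ball c r"
proof
  let ?\<phi> = "\<lambda>x. flat_exp 0 (r\<^sup>2 - (norm (x - c))\<^sup>2)"
  show nonneg: "?\<phi> x \<ge> 0" for x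
    by (simp add: flat_exp_def)
  show pos: "?\<phi> x > 0 \<longleftrightarrow> x \<in> ball c r" for x
  proof -
    have "(norm (x - c))\<^sup>2 < r\<^sup>2 \<longleftrightarrow> norm (x - c) < r"
      using assms(1) power2_less_imp_less[of "norm (x - c)" r]
        power_strict_mono[of "norm (x - c)" r 2] by auto
    then show ?thesis
      by (simp add: flat_exp_def dist_norm norm_minus_commute)
  qed
  have "?\<phi> x \<noteq> 0 \<longleftrightarrow> x \<in> ball c r" for x
    using pos[of x] nonneg[of x] by linarith
  then have "{x. ?\<phi> x \<noteq> 0} = ball c r" by blast
  moreover have "Ck_on k ?\<phi> UNIV" for k
    by (rule bump_algebra_smooth[OF bump_algebra.bump])
  ultimately show "test_function S ?\<phi>"
    using assms
    by (simp add: test_function_def closure_ball)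
qed

section \<open>From the weak to the pointwise divergence\<close>

text \<open>Since Lebesgue measure is translation invariant, the difference quotients of
  \<open>G\<close> have integral zero. They are bounded by \<open>C\<close> and live on a fixed
  ball, so dominated convergence passes to the derivative. This is all of integration by parts that
  is needed, and it avoids Fubini's theorem on a power of the real line.\<close>

lemma integral_partial_deriv_eq_0:
  fixes G :: "real^'n::finite \<Rightarrow> real"
  assumes diff: "\<And>x. G differentiable (at x)"
    and supp: "\<And>x. x \<notin> cball c r \<Longrightarrow> G x = 0"
    and bound: "\<And>x. \<bar>partial_deriv i G x\<bar> \<le> C"
  shows "integrable lborel (partial_deriv i G)" "integral\<^sup>L lborel (partial_deriv i G) = 0"
proof -
  let ?e = "axis i (1::real)"
  define h where "h = (\<lambda>n. 1 / real (Suc n))"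
  define Q where "Q = (\<lambda>n x. (G (x + h n *\<^sub>R ?e) - G x) / h n)"
  have h: "h n > 0" "h n \<le> 1" for n
    by (auto simp: h_def)
  have cont: "continuous_on UNIV G"
    using diff by (auto intro!: continuous_at_imp_continuous_on differentiable_imp_continuous_within)
  have Gm [measurable]: "G \<in> borel_measurable borel"
    using cont by (rule borel_measurable_continuous_onI)
  have "integrable lborel (\<lambda>x. indicator (cball c r) x *\<^sub>R G x)"
    by (intro borel_integrable_compact compact_cball continuous_on_subset[OF cont]) auto
  moreover have "(\<lambda>x. indicator (cball c r) x *\<^sub>R G x) = G"
    using supp by (auto simp: indicator_def fun_eq_iff)
  ultimately have intG: "integrable lborel G" by simp
  have trans: "integrable lborel (\<lambda>x. G (x + v))" "integral\<^sup>L lborel (\<lambda>x. G (x + v)) = integral\<^sup>L lborel G"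
    for v
  proof -
    have d: "distr lborel borel ((+) v) = (lborel :: (real^'n) measure)"
      by (rule lborel_distr_plus)
    show "integrable lborel (\<lambda>x. G (x + v))"
      using integrable_distr[of "(+) v" lborel borel G] intG
      by (simp add: d add.commute)
    show "integral\<^sup>L lborel (\<lambda>x. G (x + v)) = integral\<^sup>L lborel G"
      using integral_distr[of "(+) v" lborel borel G]
      by (simp add: d add.commute)
  qed
  have intQ: "integral\<^sup>L lborel (Q n) = 0" for n
    unfolding Q_def using intG trans by simp
  have lim: "(\<lambda>n. Q n x) \<longlonglongrightarrow> partial_deriv i G x" for x
  proof -
    have "((\<lambda>s. G (x + s *\<^sub>R ?e)) has_real_derivative partial_deriv i G x) (at 0)"
      using derivative_along_line[of G x 0 ?e] diff by (simp add: grad_axis)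
    then have "((\<lambda>s. (G (x + s *\<^sub>R ?e) - G x) / s) \<longlongrightarrow> partial_deriv i G x) (at 0)"
      by (simp add: has_field_derivative_iff)
    moreover have "filterlim h (at 0) sequentially"
      unfolding filterlim_at using LIMSEQ_Suc[OF lim_1_over_n] h(1)
      by (auto simp: h_def intro!: always_eventually)
    ultimately show ?thesis
      unfolding Q_def by (rule filterlim_compose)
  qed
  have dom: "norm (Q n x) \<le> C * indicator (cball c (r + 1)) x" for n x
  proof (cases "x \<in> cball c (r + 1)")
    case True
    obtain s where "G (x + h n *\<^sub>R ?e) - G x = h n * partial_deriv i G (x + s *\<^sub>R ?e)"
      by (rule mean_value_along_axis[OF h(1)[of n], of G x i]) (use diff in auto)
    then show ?thesis
      using True bound h(1)[of n] by (simp add: Q_def)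
  next
    case False
    have "dist c x \<le> dist c (x + h n *\<^sub>R ?e) + 1"
      using dist_triangle[of c x "x + h n *\<^sub>R ?e"] h[of n] by (simp add: dist_norm)
    then have "x \<notin> cball c r" "x + h n *\<^sub>R ?e \<notin> cball c r"
      using False by auto
    then show ?thesis
      using False by (simp add: Q_def supp)
  qed
  have intw: "integrable lborel (\<lambda>x. C * indicator (cball c (r + 1)) x)"
    using emeasure_compact_finite[OF compact_cball, of c "r + 1"]
    by (intro integrable_mult_right integrable_real_indicator) auto
  have Qm: "Q n \<in> borel_measurable lborel" for n
    unfolding Q_def by measurable
  have dm: "partial_deriv i G \<in> borel_measurable lborel"
    by (rule borel_measurable_LIMSEQ_real[where u = Q]) (use lim Qm in auto)
  show "integrable lborel (partial_deriv i G)"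
    by (rule integrable_dominated_convergence[where s = Q, OF dm Qm intw]) (use lim dom in auto)
  have "(\<lambda>n. integral\<^sup>L lborel (Q n)) \<longlonglongrightarrow> integral\<^sup>L lborel (partial_deriv i G)"
    by (rule integral_dominated_convergence[where s = Q, OF dm Qm intw]) (use lim dom in auto)
  then show "integral\<^sup>L lborel (partial_deriv i G) = 0"
    by (simp add: intQ LIMSEQ_const_iff)
qed

lemma nonneg_integral_0_not_pos_on_open:
  fixes f :: "'a::euclidean_space \<Rightarrow> real"
  assumes "integrable lborel f" "integral\<^sup>L lborel f = 0" "\<And>x. f x \<ge> 0"
    and "open U" "U \<noteq> {}" "\<And>x. x \<in> U \<Longrightarrow> f x > 0"
  shows False
proof -
  have "AE x in lborel. f x = 0"
    using assms(1-3) integral_nonneg_eq_0_iff_AE by blast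
  then have "AE x in lborel. x \<notin> U"
    by eventually_elim (use assms(6) in force)
  then have "U \<in> null_sets lborel"
    using assms(4) by (subst AE_iff_null_sets) auto
  then have "negligible U"
    by (simp add: negligible_iff_null_sets null_sets_completionI)
  then show False
    using open_not_negligible assms(4,5) by blast
qed

text \<open>The fundamental lemma of the calculus of variations. If the divergence had a sign near
  \<open>x0\<close>, a bump \<open>\<phi>\<close> supported there would make the integral of
  \<open>\<phi> div F\<close> nonzero; but \<open>\<phi> div F\<close> differs from \<open>- F
  \<bullet> grad \<phi>\<close>, which integrates to zero, by the divergence of the compactly
  supported field \<open>\<phi> F\<close>.\<close>

lemma weakly_divergence_free_imp_divergence_free:
  fixes F :: "real^'n::finite \<Rightarrow> real^'n"
  assumes S: "open S" "S \<subseteq> \<Omega>" "x0 \<in> S"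
    and F: "\<And>i. Ck_on 1 (\<lambda>x. F x $ i) S"
    and weak: "\<And>\<phi>. test_function \<Omega> \<phi> \<Longrightarrow> (LINT x:\<Omega>|lebesgue. F x \<bullet> grad \<phi> x) = 0"
  shows "(\<Sum>i\<in>UNIV. partial_deriv i (\<lambda>x. F x $ i) x0) = 0"
proof (rule ccontr)
  define D where "D = (\<lambda>x. \<Sum>i\<in>UNIV. partial_deriv i (\<lambda>x. F x $ i) x)"
  assume "(\<Sum>i\<in>UNIV. partial_deriv i (\<lambda>x. F x $ i) x0) \<noteq> 0"
  then have D0: "D x0 \<noteq> 0" by (simp add: D_def)
  have contD: "continuous_on S D"
    unfolding D_def by (intro continuous_on_sum Ck_on_1_imp(2)[OF F])
  \<comment> \<open>Testing with \<open>\<sigma> \<phi>\<close> instead of \<open>\<phi>\<close> treats both signs of the divergence at \<open>x0\<close> at once.\<close>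
  define \<sigma> where "\<sigma> = sgn (D x0)"
  have "\<sigma> * D x0 > 0"
    using D0 by (auto simp: \<sigma>_def sgn_if)
  moreover have "isCont (\<lambda>x. \<sigma> * D x) x0"
    using contD S(1,3) by (auto simp: continuous_on_eq_continuous_at intro!: continuous_intros)
  ultimately have "\<forall>\<^sub>F x in at x0. \<sigma> * D x > 0"
    using order_tendstoD(1)[of "\<lambda>x. \<sigma> * D x"] by (auto simp: isCont_def)
  then obtain r1 where r1: "r1 > 0" "\<And>x. dist x x0 < r1 \<Longrightarrow> \<sigma> * D x > 0"
    using \<open>\<sigma> * D x0 > 0\<close> unfolding eventually_at by (metis dist_eq_0_iff UNIV_I)
  obtain r2 where r2: "r2 > 0" "cball x0 r2 \<subseteq> S"
    using S open_contains_cball by blast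
  define r where "r = min (r1 / 2) r2"
  have r: "r > 0" "cball x0 r \<subseteq> S"
    using r1(1) r2 by (auto simp: r_def)
  have posD: "\<sigma> * D x > 0" if "x \<in> cball x0 r" for x
    using that r1 by (intro r1(2)) (auto simp: r_def dist_commute)
  obtain \<phi> where \<phi>: "test_function \<Omega> \<phi>" "\<And>x. \<phi> x \<ge> 0" "\<And>x. \<phi> x > 0 \<longleftrightarrow> x \<in> ball x0 r"
    using obtain_test_function[of r x0 \<Omega>] r S(2) by blast
  have C\<phi>: "Ck_on 1 \<phi> UNIV"
    using \<phi>(1) unfolding test_function_def by blast
  then have C\<phi>S: "Ck_on 1 \<phi> S"
    by (rule Ck_on_subset) simp
  note d\<phi> = Ck_on_1_imp(1)[OF C\<phi> UNIV_I]
  note dF = Ck_on_1_imp(1)[OF F]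
  have \<phi>0: "\<phi> x = 0" if "x \<notin> cball x0 r" for x
    using \<phi>(2)[of x] \<phi>(3)[of x] that by (auto simp: less_eq_real_def)
  have opn: "open (- cball x0 r)" by (simp add: open_Compl)
  have out: "f differentiable (at x)" "partial_deriv i f x = 0"
    if "\<And>y. y \<notin> cball x0 r \<Longrightarrow> f y = 0" "x \<notin> cball x0 r" for f :: "real^'n \<Rightarrow> real" and x i
    using partial_deriv_cong_open(1)[OF opn, of x "\<lambda>_. 0" f i]
      partial_deriv_cong_open(2)[OF opn, of x "\<lambda>_. 0" f] that
    by (simp_all add: partial_deriv_const)
  \<comment> \<open>\<open>F\<close> is controlled on \<open>S\<close> only; the cut-off \<open>G\<close> is differentiable on the whole space.\<close>
  define G where "G = (\<lambda>i x. \<phi> x * F x $ i)"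
  have G0: "G i x = 0" if "x \<notin> cball x0 r" for i x
    using that \<phi>0 by (simp add: G_def)
  have CG: "Ck_on 1 (G i) S" for i
    unfolding G_def by (rule Ck_on_1_mult[OF C\<phi>S F])
  have dG: "G i differentiable (at x)" for i x
    using Ck_on_1_imp(1)[OF CG] out(1)[OF G0] r(2) by (cases "x \<in> cball x0 r") auto
  have bG: "\<exists>C. \<forall>x. \<bar>partial_deriv i (G i) x\<bar> \<le> C" for i
  proof -
    have "continuous_on (cball x0 r) (partial_deriv i (G i))"
      using Ck_on_1_imp(2)[OF CG] r(2) by (rule continuous_on_subset)
    then have "bounded (partial_deriv i (G i) ` cball x0 r)"
      using compact_continuous_image compact_imp_bounded compact_cball by blast
    then obtain C where "C > 0" "\<And>x. x \<in> cball x0 r \<Longrightarrow> \<bar>partial_deriv i (G i) x\<bar> \<le> C"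
      unfolding bounded_pos by auto
    then have "\<bar>partial_deriv i (G i) x\<bar> \<le> C" for x
      using out(2)[OF G0] \<open>C > 0\<close> by (cases "x \<in> cball x0 r") (simp_all add: less_imp_le)
    then show ?thesis by blast
  qed
  have intG: "integrable lborel (partial_deriv i (G i))"
    "integral\<^sup>L lborel (partial_deriv i (G i)) = 0" for i
    using bG[of i] integral_partial_deriv_eq_0[OF dG G0] by blast+
  have "integrable lborel (\<lambda>x. indicator (cball x0 r) x *\<^sub>R (\<phi> x * D x))"
  proof (intro borel_integrable_compact compact_cball continuous_intros)
    show "continuous_on (cball x0 r) \<phi>"
      using Ck_on_1_continuous[OF C\<phi>S] r(2) by (rule continuous_on_subset)
    show "continuous_on (cball x0 r) D"
      using contD r(2) by (rule continuous_on_subset)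
  qed
  moreover have "(\<lambda>x. indicator (cball x0 r) x *\<^sub>R (\<phi> x * D x)) = (\<lambda>x. \<phi> x * D x)"
    using \<phi>0 by (auto simp: indicator_def fun_eq_iff)
  ultimately have int\<phi>D: "integrable lborel (\<lambda>x. \<phi> x * D x)" by simp
  have "indicator \<Omega> x *\<^sub>R (F x \<bullet> grad \<phi> x) = (\<Sum>i\<in>UNIV. partial_deriv i (G i) x) - \<phi> x * D x" for x
  proof (cases "x \<in> cball x0 r")
    case True
    then have "x \<in> S" "x \<in> \<Omega>" using r(2) S(2) by auto
    have "partial_deriv i (G i) x = \<phi> x * partial_deriv i (\<lambda>x. F x $ i) x + partial_deriv i \<phi> x * F x $ i" for i
      unfolding G_def by (rule partial_deriv_mult[OF d\<phi> dF[OF \<open>x \<in> S\<close>]])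
    then show ?thesis
      using \<open>x \<in> \<Omega>\<close>
      by (simp add: D_def inner_vec_def grad_def sum.distrib sum_distrib_left mult.commute)
  next
    case False
    then have "grad \<phi> x = 0"
      using out(2)[OF \<phi>0] by (simp add: grad_def vec_eq_iff)
    moreover have "partial_deriv i (G i) x = 0" for i
      by (rule out(2)[OF G0 False])
    ultimately show ?thesis
      using \<phi>0[OF False] by simp
  qed
  then have "(LINT x:\<Omega>|lebesgue. F x \<bullet> grad \<phi> x)
      = (\<integral>x. (\<Sum>i\<in>UNIV. partial_deriv i (G i) x) - \<phi> x * D x \<partial>lebesgue)"
    by (simp add: set_lebesgue_integral_def)
  also have "\<dots> = (\<integral>x. (\<Sum>i\<in>UNIV. partial_deriv i (G i) x) - \<phi> x * D x \<partial>lborel)"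
    using intG(1) int\<phi>D by (intro integral_completion borel_measurable_diff borel_measurable_sum) auto
  also have "\<dots> = - (\<integral>x. \<phi> x * D x \<partial>lborel)"
    using intG int\<phi>D by (simp add: Bochner_Integration.integral_diff Bochner_Integration.integral_sum
        Bochner_Integration.integrable_sum)
  finally have zero: "(\<integral>x. \<phi> x * D x \<partial>lborel) = 0"
    using weak[OF \<phi>(1)] by simp
  have eq: "(\<lambda>x. \<sigma> * (\<phi> x * D x)) = (\<lambda>x. \<phi> x * (\<sigma> * D x))" by (simp add: fun_eq_iff)
  show False
  proof (rule nonneg_integral_0_not_pos_on_open[of "\<lambda>x. \<phi> x * (\<sigma> * D x)" "ball x0 r"])
    show "integrable lborel (\<lambda>x. \<phi> x * (\<sigma> * D x))"
      unfolding eq[symmetric] using int\<phi>D by simp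
    show "(\<integral>x. \<phi> x * (\<sigma> * D x) \<partial>lborel) = 0"
      unfolding eq[symmetric] using zero by simp
    show "\<phi> x * (\<sigma> * D x) \<ge> 0" for x
      using posD[of x] \<phi>0[of x] \<phi>(2)[of x] by (cases "x \<in> cball x0 r") auto
    show "\<phi> x * (\<sigma> * D x) > 0" if "x \<in> ball x0 r" for x
      using that posD[of x] \<phi>(3)[of x] by auto
  qed (use r in auto)
qed

section \<open>The nondivergence form of the p-harmonic system\<close>

lemma norm_grad_squared:
  fixes f :: "real^'n::finite \<Rightarrow> real"
  assumes f: "Ck_on 2 f S"
  shows "Ck_on 1 (\<lambda>x. (norm (grad f x))\<^sup>2) S"
    and "\<And>x k. x \<in> S \<Longrightarrow> partial_deriv k (\<lambda>x. (norm (grad f x))\<^sup>2) x = 2 * (hessian f x *v grad f x) $ k"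
proof -
  have eq: "(\<lambda>x. (norm (grad f x))\<^sup>2) = (\<lambda>x. \<Sum>l\<in>UNIV. partial_deriv l f x * partial_deriv l f x)"
    by (simp add: fun_eq_iff power2_norm_eq_inner inner_vec_def grad_def)
  note c = Ck_on_2_partial[OF f]
  show "Ck_on 1 (\<lambda>x. (norm (grad f x))\<^sup>2) S"
    unfolding eq by (intro Ck_on_1_sum Ck_on_1_mult c finite)
  show "partial_deriv k (\<lambda>x. (norm (grad f x))\<^sup>2) x = 2 * (hessian f x *v grad f x) $ k"
    if x: "x \<in> S" for x k
  proof -
    note d = Ck_on_1_imp(1)[OF c x]
    have "partial_deriv k (\<lambda>x. (norm (grad f x))\<^sup>2) x
        = (\<Sum>l\<in>UNIV. partial_deriv k (\<lambda>x. partial_deriv l f x * partial_deriv l f x) x)"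
      unfolding eq by (intro partial_deriv_sum differentiable_mult d finite)
    also have "\<dots> = (\<Sum>l\<in>UNIV. 2 * (partial_deriv k (partial_deriv l f) x * partial_deriv l f x))"
      by (intro sum.cong refl trans[OF partial_deriv_mult[OF d d]]) simp
    finally show ?thesis
      by (simp add: sum_distrib_left matrix_vector_mult_def hessian_def grad_def)
  qed
qed

text \<open>With \<open>a = (p - 2) / 2\<close> the field is \<open>|Du|\<^bsup>p-2\<^esup> grad
  f\<close>, and the bracket on the right is the left-hand side of the nondivergence form of the
  system.\<close>

lemma divergence_of_weighted_grad:
  fixes f g :: "real^'n::finite \<Rightarrow> real"
  assumes W_def: "W = (\<lambda>x. (norm (grad f x))\<^sup>2 + (norm (grad g x))\<^sup>2)"
    and f: "Ck_on 2 f S" and g: "Ck_on 2 g S"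
    and pos: "\<And>x. x \<in> S \<Longrightarrow> W x > 0"
  shows "\<And>k. Ck_on 1 (\<lambda>x. W x powr a * partial_deriv k f x) S"
    and "\<And>x. x \<in> S \<Longrightarrow> (\<Sum>k\<in>UNIV. partial_deriv k (\<lambda>x. W x powr a * partial_deriv k f x) x)
      = W x powr (a - 1) * (W x * trace (hessian f x)
          + 2 * a * (grad f x \<bullet> (hessian f x *v grad f x + hessian g x *v grad g x)))"
proof -
  note nf = norm_grad_squared[OF f] and ng = norm_grad_squared[OF g]
  have CW: "Ck_on 1 W S"
    unfolding W_def by (rule Ck_on_1_add[OF nf(1) ng(1)])
  note CP = Ck_on_1_powr(1)[OF CW pos] and c = Ck_on_2_partial[OF f]
  show "Ck_on 1 (\<lambda>x. W x powr a * partial_deriv k f x) S" for k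
    by (rule Ck_on_1_mult[OF CP c])
  show "(\<Sum>k\<in>UNIV. partial_deriv k (\<lambda>x. W x powr a * partial_deriv k f x) x)
      = W x powr (a - 1) * (W x * trace (hessian f x)
          + 2 * a * (grad f x \<bullet> (hessian f x *v grad f x + hessian g x *v grad g x)))"
    if x: "x \<in> S" for x
  proof -
    let ?V = "hessian f x *v grad f x + hessian g x *v grad g x"
    have pW: "partial_deriv k W x = 2 * ?V $ k" for k
      unfolding W_def
      using partial_deriv_add[OF Ck_on_1_imp(1)[OF nf(1) x] Ck_on_1_imp(1)[OF ng(1) x]]
        nf(2)[OF x] ng(2)[OF x] by simp
    have split: "W x powr a = W x powr (a - 1) * W x"
      using pos[OF x] powr_add[of "W x" "a - 1" 1] by simp
    have "partial_deriv k (\<lambda>x. W x powr a * partial_deriv k f x) x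
        = W x powr (a - 1) * (W x * hessian f x $ k $ k + 2 * a * (grad f x $ k * ?V $ k))" for k
    proof -
      have "partial_deriv k (\<lambda>x. W x powr a * partial_deriv k f x) x
          = W x powr a * hessian f x $ k $ k + (a * W x powr (a - 1) * (2 * ?V $ k)) * grad f x $ k"
        using partial_deriv_mult[OF Ck_on_1_imp(1)[OF CP x] Ck_on_1_imp(1)[OF c x]]
          Ck_on_1_powr(2)[OF CW pos x] pW
        by (simp add: hessian_def grad_def)
      then show ?thesis
        unfolding split by (simp add: algebra_simps)
    qed
    then show ?thesis
      by (simp add: trace_def inner_vec_def sum_distrib_left sum.distrib distrib_left)
  qed
qed

text \<open>Where \<open>Du\<close> vanishes the equation is trivial; elsewhere the field of the
  system is \<open>C\<^sup>1\<close>, so that its weak divergence is the classical one.\<close>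

lemma p_harmonic_jet_equation:
  fixes u :: "real^2 \<Rightarrow> real^2"
  assumes \<Omega>: "open \<Omega>" "x \<in> \<Omega>" and C2: "\<And>i. Ck_on 2 (\<lambda>x. u x $ i) \<Omega>"
    and har: "p_harmonic_map p \<Omega> u" and ij: "i \<noteq> j"
  shows "jet_equation (p - 2) (grad (\<lambda>y. u y $ i) x) (grad (\<lambda>y. u y $ j) x)
    (hessian (\<lambda>y. u y $ i) x) (hessian (\<lambda>y. u y $ j) x)"
proof -
  let ?f = "\<lambda>y. u y $ i" and ?g = "\<lambda>y. u y $ j"
  define W where "W = (\<lambda>x. (norm (grad ?f x))\<^sup>2 + (norm (grad ?g x))\<^sup>2)"
  have ND: "norm_D u y = sqrt (W y)" for y
    using ij exhaust_2[of i] exhaust_2[of j] by (auto simp: norm_D_def W_def add.commute)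
  have W0: "W y \<ge> 0" for y by (simp add: W_def)
  show ?thesis
  proof (cases "W x = 0")
    case True
    then show ?thesis
      by (simp add: W_def jet_equation_def add_nonneg_eq_0_iff)
  next
    case False
    define S where "S = {y \<in> \<Omega>. W y > 0}"
    have "Ck_on 1 W \<Omega>"
      unfolding W_def by (intro Ck_on_1_add norm_grad_squared C2)
    then have "open (\<Omega> \<inter> W -` {0<..})"
      by (intro continuous_open_preimage Ck_on_1_continuous \<Omega>(1) open_greaterThan)
    moreover have "S = \<Omega> \<inter> W -` {0<..}"
      by (auto simp: S_def)
    ultimately have "open S" by simp
    have S: "x \<in> S" "S \<subseteq> \<Omega>" "\<And>y. y \<in> S \<Longrightarrow> W y > 0"
      using False W0[of x] \<Omega>(2) by (auto simp: S_def)
    note C2S = Ck_on_subset[OF C2 S(2)]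
    \<comment> \<open>\<open>F\<close> is \<open>C\<^sup>1\<close> only away from the zeros of \<open>Du\<close>, hence the restriction to \<open>S\<close>.\<close>
    define F where "F = (\<lambda>x. norm_D u x powr (p - 2) *\<^sub>R grad ?f x)"
    have F: "(\<lambda>x. F x $ k) = (\<lambda>x. W x powr ((p - 2) / 2) * partial_deriv k ?f x)" for k
      using W0 by (simp add: fun_eq_iff F_def ND grad_def powr_half_sqrt[symmetric] powr_powr)
    note dv = divergence_of_weighted_grad[OF W_def C2S C2S S(3)]
    have div0: "(\<Sum>k\<in>UNIV. partial_deriv k (\<lambda>x. F x $ k) x) = 0"
    proof (rule weakly_divergence_free_imp_divergence_free[OF \<open>open S\<close> S(2,1)])
      show "Ck_on 1 (\<lambda>x. F x $ k) S" for k
        unfolding F by (rule dv(1))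
      show "(LINT x:\<Omega>|lebesgue. F x \<bullet> grad \<phi> x) = 0" if "test_function \<Omega> \<phi>" for \<phi>
        using har that unfolding p_harmonic_map_def F_def by blast
    qed
    have "W x powr ((p - 2) / 2 - 1) * (W x * trace (hessian ?f x)
        + 2 * ((p - 2) / 2) * (grad ?f x \<bullet> (hessian ?f x *v grad ?f x + hessian ?g x *v grad ?g x))) = 0"
      by (rule trans[OF dv(2)[OF _ S(1), symmetric] div0[unfolded F]])
    moreover have "W x powr ((p - 2) / 2 - 1) \<noteq> 0"
      using S(3)[OF S(1)] by simp
    moreover have "2 * ((p - 2) / 2) = p - 2" by simp
    ultimately show ?thesis
      by (simp only: jet_equation_def W_def mult_eq_0_iff simp_thms)
  qed
qed

section \<open>Blow-up at critical points\<close>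

lemma jet_equation_scaleR:
  fixes A B :: "real^'n::finite^'n"
  assumes "jet_equation q g h A B"
  shows "jet_equation q (c *\<^sub>R g) (c *\<^sub>R h) A B"
proof -
  have n: "(norm (c *\<^sub>R k))\<^sup>2 = c\<^sup>2 * (norm k)\<^sup>2" for k :: "real^'n"
    by (simp add: power_mult_distrib)
  have i: "c *\<^sub>R g \<bullet> (A *v c *\<^sub>R g + B *v c *\<^sub>R h) = c\<^sup>2 * (g \<bullet> (A *v g + B *v h))"
    by (simp add: matrix_vector_mult_scaleR inner_add_right power2_eq_square algebra_simps)
  have "((norm g)\<^sup>2 + (norm h)\<^sup>2) * trace A + q * (g \<bullet> (A *v g + B *v h)) = 0"
    using assms by (simp add: jet_equation_def)
  then show ?thesis
    unfolding jet_equation_def n i by algebra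
qed

lemma jet_equation_tendsto:
  fixes A B :: "real^'n::finite^'n"
  assumes lim: "(G \<longlongrightarrow> g) F" "(K \<longlongrightarrow> h) F" "(M \<longlongrightarrow> A) F" "(N \<longlongrightarrow> B) F"
    and "F \<noteq> bot" and ev: "\<forall>\<^sub>F t in F. jet_equation q (G t) (K t) (M t) (N t)"
  shows "jet_equation q g h A B"
proof -
  let ?E = "\<lambda>g h A B. ((norm g)\<^sup>2 + (norm h)\<^sup>2) * (\<Sum>i\<in>UNIV. A $ i $ i)
      + q * (\<Sum>i\<in>UNIV. g $ i * ((\<Sum>j\<in>UNIV. A $ i $ j * g $ j) + (\<Sum>j\<in>UNIV. B $ i $ j * h $ j)))"
  have E: "jet_equation q g h A B \<longleftrightarrow> ?E g h A B = 0"
    for g h :: "real^'n" and A B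
    by (simp add: jet_equation_def trace_def inner_vec_def matrix_vector_mult_def)
  have "((\<lambda>t. ?E (G t) (K t) (M t) (N t)) \<longlongrightarrow> ?E g h A B) F"
    by (intro tendsto_intros lim)
  moreover have "((\<lambda>t. ?E (G t) (K t) (M t) (N t)) \<longlongrightarrow> 0) F"
    by (rule tendsto_eventually) (use ev in \<open>simp add: E\<close>)
  ultimately show ?thesis
    unfolding E using tendsto_unique[OF assms(5)] by blast
qed

text \<open>The difference quotients of the gradient lose their constant term at a critical point; their
  limit has the Hessian acting on the other index, which its symmetry corrects.\<close>

lemma grad_blow_up:
  fixes f :: "real^'n::finite \<Rightarrow> real"
  assumes S: "open S" "x \<in> S" and f: "Ck_on 2 f S" and crit: "grad f x = 0"
  shows "((\<lambda>t. (1 / t) *\<^sub>R grad f (x + t *\<^sub>R v)) \<longlongrightarrow> hessian f x *v v) (at 0)"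
    and "((\<lambda>t. hessian f (x + t *\<^sub>R v)) \<longlongrightarrow> hessian f x) (at 0)"
proof -
  note c = Ck_on_2_partial[OF f]
  show "((\<lambda>t. (1 / t) *\<^sub>R grad f (x + t *\<^sub>R v)) \<longlongrightarrow> hessian f x *v v) (at 0)"
  proof (rule vec_tendstoI)
    fix k
    have "partial_deriv k f differentiable (at (x + 0 *\<^sub>R v))"
      using Ck_on_1_imp(1)[OF c S(2)] by simp
    from derivative_along_line[OF this]
    have "((\<lambda>s. (partial_deriv k f (x + s *\<^sub>R v) - partial_deriv k f x) / s)
        \<longlongrightarrow> grad (partial_deriv k f) x \<bullet> v) (at 0)"
      by (simp add: has_field_derivative_iff)
    moreover have "partial_deriv k f x = 0"
      using crit by (simp add: grad_def vec_eq_iff)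
    moreover have "grad (partial_deriv k f) x \<bullet> v = (hessian f x *v v) $ k"
      using mixed_partial_derivs_commute[OF S f]
      by (simp add: grad_def inner_vec_def matrix_vector_mult_def hessian_def)
    ultimately show "((\<lambda>t. ((1 / t) *\<^sub>R grad f (x + t *\<^sub>R v)) $ k) \<longlongrightarrow> (hessian f x *v v) $ k) (at 0)"
      by (simp add: grad_def)
  qed
  show "((\<lambda>t. hessian f (x + t *\<^sub>R v)) \<longlongrightarrow> hessian f x) (at 0)"
  proof (intro vec_tendstoI)
    fix k l
    have "isCont (partial_deriv k (partial_deriv l f)) x"
      using Ck_on_1_imp(2)[OF c] S continuous_on_eq_continuous_at by blast
    moreover have "((\<lambda>t. x + t *\<^sub>R v) \<longlongrightarrow> x) (at 0)"
      by (auto intro!: tendsto_eq_intros)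
    ultimately have "((\<lambda>t. partial_deriv k (partial_deriv l f) (x + t *\<^sub>R v))
        \<longlongrightarrow> partial_deriv k (partial_deriv l f) x) (at 0)"
      by (rule isCont_tendsto_compose)
    then show "((\<lambda>t. hessian f (x + t *\<^sub>R v) $ k $ l) \<longlongrightarrow> hessian f x $ k $ l) (at 0)"
      by (simp add: hessian_def)
  qed
qed

text \<open>The equation at a critical point of the map carries no information, but it is
  homogeneous in the gradients. Dividing the equations at \<open>x + t v\<close> by
  \<open>t\<^sup>2\<close> and letting \<open>t\<close> tend to zero gives an equation for the
  Hessians at \<open>x\<close> in which \<open>H v\<close> takes the place of the gradient.\<close>

lemma jet_equation_at_critical_point:
  fixes f g :: "real^'n::finite \<Rightarrow> real"
  assumes S: "open S" "x \<in> S" and f: "Ck_on 2 f S" and g: "Ck_on 2 g S"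
    and crit: "grad f x = 0" "grad g x = 0"
    and jet: "\<And>y. y \<in> S \<Longrightarrow> jet_equation q (grad f y) (grad g y) (hessian f y) (hessian g y)"
  shows "jet_equation q (hessian f x *v v) (hessian g x *v v) (hessian f x) (hessian g x)"
proof (rule jet_equation_tendsto[OF grad_blow_up(1)[OF S f crit(1)] grad_blow_up(1)[OF S g crit(2)]
      grad_blow_up(2)[OF S f crit(1)] grad_blow_up(2)[OF S g crit(2)]])
  have "((\<lambda>t. x + t *\<^sub>R v) \<longlongrightarrow> x) (at (0::real))"
    by (auto intro!: tendsto_eq_intros)
  then have "\<forall>\<^sub>F t in at (0::real). x + t *\<^sub>R v \<in> S"
    using S by (rule topological_tendstoD)
  then show "\<forall>\<^sub>F t in at 0. jet_equation q ((1 / t) *\<^sub>R grad f (x + t *\<^sub>R v))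
      ((1 / t) *\<^sub>R grad g (x + t *\<^sub>R v)) (hessian f (x + t *\<^sub>R v)) (hessian g (x + t *\<^sub>R v))"
    by eventually_elim (intro jet_equation_scaleR jet)
qed simp

section \<open>Determinants of the Hessians\<close>

text \<open>The algebraic lemma needs one nonzero gradient. At a zero of \<open>Du\<close> the
  blown-up gradients serve instead.\<close>

lemma p_harmonic_det_hessian_neg:
  fixes u :: "real^2 \<Rightarrow> real^2"
  assumes \<Omega>: "open \<Omega>" "x \<in> \<Omega>" and C2: "\<And>i. Ck_on 2 (\<lambda>x. u x $ i) \<Omega>"
    and p: "1 < p" "p < 6" and har: "p_harmonic_map p \<Omega> u" and ij: "i \<noteq> j"
    and det_i: "det (hessian (\<lambda>y. u y $ i) x) > 0"
  shows "det (hessian (\<lambda>y. u y $ j) x) < 0"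
proof (rule ccontr)
  let ?f = "\<lambda>y. u y $ i" and ?g = "\<lambda>y. u y $ j"
  assume "\<not> det (hessian ?g x) < 0"
  then have det_j: "det (hessian ?g x) \<ge> 0" by simp
  have jet: "jet_equation (p - 2) (grad ?f y) (grad ?g y) (hessian ?f y) (hessian ?g y)"
    "jet_equation (p - 2) (grad ?g y) (grad ?f y) (hessian ?g y) (hessian ?f y)" if "y \<in> \<Omega>" for y
    by (rule p_harmonic_jet_equation[OF \<Omega>(1) that C2 har ij])
      (rule p_harmonic_jet_equation[OF \<Omega>(1) that C2 har ij[symmetric]])
  have no: False
    if "g \<noteq> 0 \<or> h \<noteq> 0" "jet_equation (p - 2) g h (hessian ?f x) (hessian ?g x)"
      "jet_equation (p - 2) h g (hessian ?g x) (hessian ?f x)" for g h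
    using no_definite_jet[OF _ _ hessian_symmetric[OF \<Omega> C2] hessian_symmetric[OF \<Omega> C2] det_i det_j that]
      p by simp
  show False
  proof (cases "grad ?f x = 0 \<and> grad ?g x = 0")
    case False
    then show False using no[OF _ jet[OF \<Omega>(2)]] by simp
  next
    case True
    \<comment> \<open>Any direction will do: \<open>hessian ?f x\<close> is invertible, so the blown-up gradients do not both vanish.\<close>
    let ?v = "axis 1 1 :: real^2"
    have "hessian ?f x *v ?v \<noteq> 0"
    proof
      assume "hessian ?f x *v ?v = 0"
      then have "hessian ?f x $ 1 $ 1 = 0" "hessian ?f x $ 2 $ 1 = 0"
        by (simp_all add: matrix_vector_mult_basis column_def vec_eq_iff)
      then show False using det_i by (simp add: det_2)
    qed
    then show False
      using no[of "hessian ?f x *v ?v" "hessian ?g x *v ?v"]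
        jet_equation_at_critical_point[OF \<Omega> C2 C2 _ _ jet(1), of ?v]
        jet_equation_at_critical_point[OF \<Omega> C2 C2 _ _ jet(2), of ?v] True by simp
  qed
qed

theorem theorem2:
  fixes p :: real and \<Omega> :: "(real^2) set" and u :: "real^2 \<Rightarrow> real^2"
  assumes "4 / 3 \<le> p" and "p \<le> 2 + sqrt 2"
    and "open \<Omega>" and "connected \<Omega>" and "\<Omega> \<noteq> {}"
    and "\<forall>i. Ck_on 2 (\<lambda>x. u x $ i) \<Omega>"
    and "p_harmonic_map p \<Omega> u"
  shows "(\<forall>x\<in>\<Omega>. det (hessian (\<lambda>y. u y $ 2) x) \<ge> 0 \<longrightarrow> det (hessian (\<lambda>y. u y $ 1) x) \<le> 0) \<and>
    ((\<forall>x\<in>\<Omega>. det (hessian (\<lambda>y. u y $ 2) x) \<ge> 0) \<longrightarrow>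
       (\<forall>x\<in>\<Omega>. gauss_curvature (\<lambda>y. u y $ 1) x \<le> 0)) \<and>
    ((\<forall>x\<in>\<Omega>. det (hessian (\<lambda>y. u y $ 1) x) \<ge> 0) \<longrightarrow>
       (\<forall>x\<in>\<Omega>. gauss_curvature (\<lambda>y. u y $ 2) x \<le> 0))"
proof -
  have "sqrt 2 < 4"
    by (rule real_less_lsqrt) auto
  then have p: "1 < p" "p < 6"
    using assms(1,2) by auto
  have C2: "Ck_on 2 (\<lambda>x. u x $ i) \<Omega>" for i
    using assms(6) by blast
  have det: "det (hessian (\<lambda>y. u y $ i) x) \<le> 0"
    if "x \<in> \<Omega>" "i \<noteq> j" "det (hessian (\<lambda>y. u y $ j) x) \<ge> 0" for x i j
    using p_harmonic_det_hessian_neg[OF assms(3) that(1) C2 p assms(7) that(2)] that(3)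
    by fastforce
  have curv: "gauss_curvature (\<lambda>y. u y $ i) x \<le> 0"
    if x: "x \<in> \<Omega>" and "i \<noteq> j" "det (hessian (\<lambda>y. u y $ j) x) \<ge> 0" for x i j
  proof -
    have "hessian (\<lambda>y. u y $ i) x $ 2 $ 1 = hessian (\<lambda>y. u y $ i) x $ 1 $ 2"
      by (rule symmetric_matrix_nth[OF hessian_symmetric[OF assms(3) x C2]])
    then have "gauss_curvature (\<lambda>y. u y $ i) x = det (hessian (\<lambda>y. u y $ i) x) /
        (1 + (partial_deriv 1 (\<lambda>y. u y $ i) x)\<^sup>2 + (partial_deriv 2 (\<lambda>y. u y $ i) x)\<^sup>2)\<^sup>2"
      by (simp add: gauss_curvature_def det_2 power2_eq_square)
    then show ?thesis
      using det[OF that] by (simp add: divide_nonpos_nonneg)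
  qed
  have "(1::2) \<noteq> 2" "(2::2) \<noteq> 1" by simp_all
  then show ?thesis
    using det curv by blast
qed

end
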